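(* Let $n\ge 3$ and $k\ge 5$ be integers. Then every set of functions $f_1,\dots,f_n$ (one per agent) that assigns agents to tasks so that every demand vector is exactly satisfied has maximum switching cost at least $3$.
   Context: There are $n$ agents, labelled $1,\dots,n$, and $k$ tasks, labelled $1,\dots,k$. A demand vector is a vector $\vec v=(v_1,\dots,v_k)$ of non-negative integers with $\sum_i v_i=n$. A set of functions $f_1,\dots,f_n$, each mapping demand vectors to $[k]=\{1,\dots,k\}$, is required to satisfy the demand: for every demand vector $\vec v$ and every task $j$, the number of agents $a$ with $f_a(\vec v)=j$ is exactly $v_j$. The switching cost of a pair $(\vec v,\vec v')$ is the number of agents $a$ with $f_a(\vec v)\neq f_a(\vec v')$. Two demand vectors are adjacent if $\|\vec v-\vec v'\|_1=2$, i.e. one is obtained from the other by moving one unit of demand from one task to another. The maximum switching cost of $f_1,\dots,f_n$ is the maximum switching cost over all pairs of adjacent demand vectors. *)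

theory Defs
  imports Main
begin

definition demand_vectors :: "nat \<Rightarrow> nat \<Rightarrow> (nat \<Rightarrow> nat) set" where
  "demand_vectors n k = {v. (\<forall>j. j \<notin> {1..k} \<longrightarrow> v j = 0) \<and> (\<Sum>j\<in>{1..k}. v j) = n}"

text \<open>f a v is the task assigned to agent a (1..n) under demand vector v.\<close>
definition satisfies_demand :: "nat \<Rightarrow> nat \<Rightarrow> (nat \<Rightarrow> (nat \<Rightarrow> nat) \<Rightarrow> nat) \<Rightarrow> bool" where
  "satisfies_demand n k f \<longleftrightarrow>
     (\<forall>v\<in>demand_vectors n k.
        (\<forall>a\<in>{1..n}. f a v \<in> {1..k}) \<and>
        (\<forall>j\<in>{1..k}. card {a\<in>{1..n}. f a v = j} = v j))"

definition switching_cost :: "nat \<Rightarrow> (nat \<Rightarrow> (nat \<Rightarrow> nat) \<Rightarrow> nat) \<Rightarrow> (nat \<Rightarrow> nat) \<Rightarrow> (nat \<Rightarrow> nat) \<Rightarrow> nat" where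
  "switching_cost n f v v' = card {a\<in>{1..n}. f a v \<noteq> f a v'}"

definition adjacent :: "nat \<Rightarrow> (nat \<Rightarrow> nat) \<Rightarrow> (nat \<Rightarrow> nat) \<Rightarrow> bool" where
  "adjacent k v v' \<longleftrightarrow> (\<Sum>j\<in>{1..k}. (if v j \<le> v' j then v' j - v j else v j - v' j)) = 2"

definition max_switching_cost :: "nat \<Rightarrow> nat \<Rightarrow> (nat \<Rightarrow> (nat \<Rightarrow> nat) \<Rightarrow> nat) \<Rightarrow> nat" where
  "max_switching_cost n k f =
     Max {switching_cost n f v v' | v v'. v \<in> demand_vectors n k \<and> v' \<in> demand_vectors n k \<and> adjacent k v v'}"

end

(*
  Suppose every switch costs at most 2. Moving one unit of demand from i to j is then done by one
  agent going from i to j, or by a relay of two agents i -> l -> j. Fix a task z and record the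
  demand as a multiset M of tasks other than z, the remaining agents working on z. By the relay
  description, the set "off z M" of the agents not on z grows by one agent with each task added
  to M. Let "first z x" be the agent off z when M = {x}.

  If first z x = first z y for some x and y, then on all pairs from x, y and two further tasks the
  same two agents e and q are off z. The task of e on each pair defines a tournament on four tasks.
  It has no 3-cycle, since e would have no place in that triple, and along a chain t > x > y > w
  the switch from {t, x, y} to {w, x, y} would move e, q and a third agent.

  So first z is injective, and in particular n >= 4. Then first z x works on x whenever x is in
  demand, so this agent can be removed together with one unit of demand for x, and we are done by
  induction on n.
*)
theory Submission
  imports Defs "HOL-Library.Multiset"
begin

section \<open>Assignments in which a switch moves at most two agents\<close>

text \<open>With demands as multisets of tasks, moving one unit of demand exchanges one element next
  to a common rest \<open>R\<close>. Agents form an arbitrary set, so that the induction can delete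
  any one of them.\<close>

locale low_cost_assignment =
  fixes N :: "'a set" and T :: "'t set" and g :: "'t multiset \<Rightarrow> 'a \<Rightarrow> 't"
  assumes finite_agents: "finite N"
    and demand_met:
      "set_mset M \<subseteq> T \<Longrightarrow> size M = card N \<Longrightarrow> image_mset (g M) (mset_set N) = M"
    and cost_le_2:
      "i \<in> T \<Longrightarrow> j \<in> T \<Longrightarrow> set_mset R \<subseteq> T \<Longrightarrow> Suc (size R) = card N \<Longrightarrow>
        card {a \<in> N. g (add_mset i R) a \<noteq> g (add_mset j R) a} \<le> 2"
begin

lemma card_task:
  assumes "set_mset M \<subseteq> T" "size M = card N"
  shows "card {a \<in> N. g M a = t} = count M t"
proof -
  have "count M t = count (image_mset (g M) (mset_set N)) t"
    using demand_met[OF assms] by simp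
  also have "\<dots> = card {a \<in> N. g M a = t}"
    using finite_agents
    by (simp add: count_image_mset Int_def vimage_def conj_commute)
  finally show ?thesis ..
qed

text \<open>Agents outside \<open>D\<close> contribute equally to both demands. Balancing the at
  most two agents of \<open>D\<close> against the exchange of \<open>i\<close> for \<open>j\<close>
  leaves only a direct move or a relay through some \<open>l\<close>.\<close>

lemma shift_cases:
  assumes "i \<in> T" "j \<in> T" "i \<noteq> j" "set_mset R \<subseteq> T" "Suc (size R) = card N"
  obtains (one) a where "a \<in> N" "g (add_mset i R) a = i" "g (add_mset j R) a = j"
      "\<And>c. c \<in> N \<Longrightarrow> c \<noteq> a \<Longrightarrow> g (add_mset i R) c = g (add_mset j R) c"
  | (two) a b l where "a \<in> N" "b \<in> N" "a \<noteq> b" "l \<noteq> i" "l \<noteq> j"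
      "g (add_mset i R) a = i" "g (add_mset j R) a = l"
      "g (add_mset i R) b = l" "g (add_mset j R) b = j"
      "\<And>c. c \<in> N \<Longrightarrow> c \<noteq> a \<Longrightarrow> c \<noteq> b \<Longrightarrow> g (add_mset i R) c = g (add_mset j R) c"
proof -
  define p where "p = g (add_mset i R)"
  define q where "q = g (add_mset j R)"
  define D where "D = {a \<in> N. p a \<noteq> q a}"
  have D: "finite D" "D \<subseteq> N" "card D \<le> 2"
    using finite_agents cost_le_2[of i j R] assms by (auto simp: D_def p_def q_def)
  have "image_mset p (mset_set N) = add_mset i R" "image_mset q (mset_set N) = add_mset j R"
    using demand_met[of "add_mset i R"] demand_met[of "add_mset j R"] assms
    by (auto simp: p_def q_def)
  moreover have "mset_set N = mset_set D + mset_set (N - D)"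
    using mset_set_Union[of D "N - D"] D finite_agents by (simp add: Un_absorb1)
  moreover have "image_mset p (mset_set (N - D)) = image_mset q (mset_set (N - D))"
    using finite_agents by (intro image_mset_cong) (auto simp: D_def)
  ultimately have
    eqs: "image_mset p (mset_set D) + image_mset q (mset_set (N - D)) = add_mset i R"
      "image_mset q (mset_set D) + image_mset q (mset_set (N - D)) = add_mset j R"
    by auto
  have "add_mset j (image_mset p (mset_set D)) + image_mset q (mset_set (N - D)) =
     add_mset i (image_mset q (mset_set D)) + image_mset q (mset_set (N - D))"
    using eqs by simp
  then have bal: "add_mset j (image_mset p (mset_set D)) = add_mset i (image_mset q (mset_set D))"
    by simp
  consider "card D = 0" | "card D = 1" | "card D = 2" using D by linarith
  then show ?thesis
  proof cases
    case 1
    then show ?thesis using D bal assms by simp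
  next
    case 2
    then obtain a where a: "D = {a}" by (auto simp: card_1_singleton_iff)
    have "p a = i" "q a = j"
      using bal assms(3) a by (auto simp: add_eq_conv_ex)
    then show ?thesis using a by (intro one[of a]) (auto simp: D_def p_def q_def)
  next
    case 3
    then obtain a b where ab: "D = {a, b}" "a \<noteq> b" by (auto simp: card_2_iff)
    then have bal': "{#j, p a, p b#} = {#i, q a, q b#}" using bal by simp
    have ne: "p a \<noteq> q a" "p b \<noteq> q b" "a \<in> N" "b \<in> N"
      using ab by (auto simp: D_def)
    have rest: "p c = q c" if "c \<in> N" "c \<noteq> a" "c \<noteq> b" for c
      using that ab by (auto simp: D_def)
    \<comment> \<open>Used with \<open>x\<close>, \<open>x'\<close>, \<open>y\<close> as the old
      task of the second runner, the new task of the first and the new task of the second. Once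
      \<open>i\<close> is cancelled, \<open>y\<close> cannot be matched with \<open>x\<close>, so it
      is \<open>j\<close>.\<close>
    have cancel: "x = x' \<and> y = j \<and> x' \<noteq> i \<and> x' \<noteq> j"
      if "{#j, i, x#} = {#i, x', y#}" "x' \<noteq> i" "x \<noteq> y" for x x' y
    proof -
      have "add_mset i {#j, x#} = add_mset i {#x', y#}" using that(1) by (simp add: add_mset_commute)
      then have eq: "{#j, x#} = {#x', y#}" by (simp only: add_mset_add_mset_same_iff)
      then have "y \<in># {#j, x#}" by simp
      then have y: "y = j" using that(3) by auto
      have "add_mset j {#x#} = add_mset j {#x'#}" using eq y by (simp add: add_mset_commute)
      then have "x = x'" by (simp only: add_mset_add_mset_same_iff single_eq_single)
      then show ?thesis using that y by auto
    qed
    have "i \<in># {#j, p a, p b#}" using bal' by simp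
    then consider "p a = i" | "p b = i" using assms by auto
    then consider "p a = i" "q b = j" "p b = q a" "q a \<noteq> i" "q a \<noteq> j"
      | "p b = i" "q a = j" "p a = q b" "q b \<noteq> i" "q b \<noteq> j"
    proof cases
      case 1
      then show ?thesis
        using cancel[of "p b" "q a" "q b"] bal' ne that(1) by auto
    next
      case 2
      then show ?thesis
        using cancel[of "p a" "q b" "q a"] bal' ne that(2)
        by (simp add: add_mset_commute)
    qed
    then show ?thesis
    proof cases
      case 1
      show ?thesis
        by (rule two[of a b "q a"])
          (use 1 ne rest ab in \<open>simp_all add: p_def[symmetric] q_def[symmetric]\<close>)
    next
      case 2
      show ?thesis
        by (rule two[of b a "q b"])
          (use 2 ne rest ab in \<open>simp_all add: p_def[symmetric] q_def[symmetric]\<close>)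
    qed
  qed
qed

lemma leave_or_join:
  assumes "i \<in> T" "j \<in> T" "i \<noteq> j" "set_mset R \<subseteq> T" "Suc (size R) = card N"
    and "c \<in> N" "g (add_mset i R) c \<noteq> g (add_mset j R) c"
  shows "g (add_mset i R) c = i \<or> g (add_mset j R) c = j"
  using assms(1-5) by (rule shift_cases) (use assms(6,7) in metis)+

text \<open>A switching agent that does not leave \<open>i\<close> can only be the second runner;
  the first runner then takes over its old task.\<close>

lemma relay:
  assumes "i \<in> T" "j \<in> T" "i \<noteq> j" "set_mset R \<subseteq> T" "Suc (size R) = card N"
    and "b \<in> N" "g (add_mset i R) b \<noteq> g (add_mset j R) b" "g (add_mset i R) b \<noteq> i"
  obtains a where "a \<in> N" "a \<noteq> b" "g (add_mset i R) a = i"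
    "g (add_mset j R) a = g (add_mset i R) b" "g (add_mset j R) b = j"
    "\<And>c. c \<in> N \<Longrightarrow> c \<noteq> a \<Longrightarrow> c \<noteq> b \<Longrightarrow> g (add_mset i R) c = g (add_mset j R) c"
  using assms(1-5) by (rule shift_cases) (use assms(6-8) that in metis)+

section \<open>Demands padded with a base task\<close>

text \<open>Padding with \<open>z\<close> makes demands of different sizes comparable: enlarging
  \<open>M\<close> becomes a switch away from \<open>z\<close>. The truncated subtraction is
  harmless as long as \<open>size M \<le> card N\<close>.\<close>

definition pos :: "'t \<Rightarrow> 't multiset \<Rightarrow> 'a \<Rightarrow> 't" where
  "pos z M = g (M + replicate_mset (card N - size M) z)"

definition off :: "'t \<Rightarrow> 't multiset \<Rightarrow> 'a set" where
  "off z M = {a \<in> N. pos z M a \<noteq> z}"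

text \<open>The choice is unambiguous for a task \<open>x\<close> other than \<open>z\<close> as
  soon as there is an agent, since \<open>{#x#}\<close> puts exactly one agent on
  \<open>x\<close>.\<close>

definition first :: "'t \<Rightarrow> 't \<Rightarrow> 'a" where
  "first z x = (SOME a. a \<in> N \<and> pos z {#x#} a = x)"

end

locale based_assignment = low_cost_assignment N T g
  for N :: "'a set" and T :: "'t set" and g :: "'t multiset \<Rightarrow> 'a \<Rightarrow> 't" +
  fixes z :: 't
  assumes base_in: "z \<in> T"
begin

lemma card_pos:
  assumes "set_mset M \<subseteq> T - {z}" "size M \<le> card N" "t \<noteq> z"
  shows "card {a \<in> N. pos z M a = t} = count M t"
proof -
  have "card {a \<in> N. pos z M a = t} = count (M + replicate_mset (card N - size M) z) t"
    unfolding pos_def by (rule card_task) (use assms base_in in auto)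
  then show ?thesis using assms(3) by simp
qed

lemma ex_pos:
  assumes "set_mset M \<subseteq> T - {z}" "size M \<le> card N" "t \<in># M"
  shows "\<exists>a\<in>N. pos z M a = t"
proof -
  have "t \<noteq> z" "count M t \<noteq> 0" using assms by auto
  then have "card {a \<in> N. pos z M a = t} \<noteq> 0" using card_pos[OF assms(1,2)] by metis
  then show ?thesis by (metis (mono_tags, lifting) Collect_empty_eq card.empty)
qed

lemma pos_unique:
  assumes "set_mset M \<subseteq> T - {z}" "size M \<le> card N" "count M t = 1"
    and "a \<in> N" "b \<in> N" "pos z M a = t" "pos z M b = t"
  shows "a = b"
proof -
  have "t \<in># M" using assms(3) by (metis count_eq_zero_iff zero_neq_one)
  then have "card {a \<in> N. pos z M a = t} = 1"
    using card_pos[OF assms(1,2), of t] assms by auto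
  then obtain c where c: "{a \<in> N. pos z M a = t} = {c}" by (rule card_1_singletonE)
  have "a \<in> {a \<in> N. pos z M a = t}" "b \<in> {a \<in> N. pos z M a = t}"
    using assms by simp_all
  then show ?thesis unfolding c by simp
qed

lemma pos_mem:
  assumes "set_mset M \<subseteq> T - {z}" "size M \<le> card N" "a \<in> N" "pos z M a \<noteq> z"
  shows "pos z M a \<in># M"
proof -
  have "{b \<in> N. pos z M b = pos z M a} \<noteq> {}" using assms by blast
  then have "card {b \<in> N. pos z M b = pos z M a} \<noteq> 0"
    using finite_agents by (simp add: card_eq_0_iff)
  then have "count M (pos z M a) \<noteq> 0" using card_pos[OF assms(1,2,4)] by simp
  then show ?thesis by (meson count_eq_zero_iff)
qed

lemma card_off:
  assumes "set_mset M \<subseteq> T - {z}" "size M \<le> card N"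
  shows "card (off z M) = size M"
proof -
  have "card {a \<in> N. pos z M a = z} = count (M + replicate_mset (card N - size M) z) z"
    unfolding pos_def by (rule card_task) (use assms base_in in auto)
  also have "\<dots> = card N - size M"
  proof -
    have "count M z = 0" using assms by (auto simp: count_eq_zero_iff)
    then show ?thesis by simp
  qed
  finally have "card {a \<in> N. pos z M a = z} = card N - size M" .
  moreover have "off z M = N - {a \<in> N. pos z M a = z}" by (auto simp: off_def)
  ultimately show ?thesis using assms(2) finite_agents by (simp add: card_Diff_subset)
qed

lemma finite_off: "finite (off z M)"
  using finite_agents by (simp add: off_def)

context
  fixes M :: "'t multiset"
  assumes M: "set_mset M \<subseteq> T - {z}" "size M < card N"
begin

lemma pos_add:
  "pos z (add_mset x M) = g (add_mset x (M + replicate_mset (card N - Suc (size M)) z))"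
  by (simp add: pos_def)

text \<open>One filler is split off, so that \<open>M\<close> and \<open>add_mset x M\<close> have
  the same rest and differ only by \<open>z\<close> against \<open>x\<close>.\<close>

lemma pos_eq: "pos z M = g (add_mset z (M + replicate_mset (card N - Suc (size M)) z))"
proof -
  have "card N - size M = Suc (card N - Suc (size M))" using M by simp
  then show ?thesis by (simp add: pos_def)
qed

lemma filler:
  "set_mset (M + replicate_mset (card N - Suc (size M)) z) \<subseteq> T"
  "Suc (size (M + replicate_mset (card N - Suc (size M)) z)) = card N"
  using M base_in by (auto simp: in_replicate_mset)

text \<open>The switch goes from \<open>z\<close> to \<open>x\<close>, and an agent off
  \<open>z\<close> cannot leave \<open>z\<close>; if it switches, it joins \<open>x\<close>.\<close>

lemma up_pos:
  assumes "x \<in> T - {z}" "a \<in> N" "pos z M a \<noteq> z"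
  shows "pos z (add_mset x M) a = pos z M a \<or> pos z (add_mset x M) a = x"
  using leave_or_join[OF base_in _ _ filler, of x a] assms unfolding pos_add pos_eq
  by (metis DiffD1 DiffD2 singletonI)

lemma swap_pos:
  assumes "x \<in> T - {z}" "y \<in> T - {z}" "x \<noteq> y" "a \<in> N"
    "pos z (add_mset x M) a \<noteq> pos z (add_mset y M) a"
  shows "pos z (add_mset x M) a = x \<or> pos z (add_mset y M) a = y"
  using leave_or_join[OF _ _ _ filler, of x y a] assms by (auto simp: pos_add)

lemma swap_relay:
  assumes "x \<in> T - {z}" "y \<in> T - {z}" "x \<noteq> y" "b \<in> N"
    "pos z (add_mset x M) b \<noteq> pos z (add_mset y M) b" "pos z (add_mset x M) b \<noteq> x"
  obtains a where "a \<in> N" "a \<noteq> b" "pos z (add_mset x M) a = x"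
    "pos z (add_mset y M) a = pos z (add_mset x M) b" "pos z (add_mset y M) b = y"
    "\<And>c. c \<in> N \<Longrightarrow> c \<noteq> a \<Longrightarrow> c \<noteq> b \<Longrightarrow> pos z (add_mset x M) c = pos z (add_mset y M) c"
  using relay[OF _ _ _ filler, of x y b] assms unfolding pos_add by (metis DiffD1)

end

section \<open>First agents stay on their tasks\<close>

lemma first_pos:
  assumes "x \<in> T - {z}" "1 \<le> card N"
  shows "first z x \<in> N" "pos z {#x#} (first z x) = x"
proof -
  have "\<exists>a. a \<in> N \<and> pos z {#x#} a = x" using ex_pos[of "{#x#}" x] assms by auto
  from someI_ex[OF this] show "first z x \<in> N" "pos z {#x#} (first z x) = x"
    by (auto simp: first_def)
qed

lemma first_pos_pair:
  assumes "x \<in> T - {z}" "y \<in> T - {z}" "2 \<le> card N"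
  shows "pos z {#x, y#} (first z x) \<in> {x, y}"
  using up_pos[of "{#x#}" y "first z x"] first_pos[of x] assms by (auto simp: add_mset_commute)

lemma first_in_off_pair:
  assumes "x \<in> T - {z}" "y \<in> T - {z}" "2 \<le> card N"
  shows "first z x \<in> off z {#x, y#}"
  using first_pos_pair[OF assms] first_pos[of x] assms by (auto simp: off_def)

text \<open>Otherwise the first agents of \<open>x\<close> and \<open>y\<close> are swapped on this
  pair. On \<open>{#x, w#}\<close> only the first agents of \<open>x\<close> and \<open>w\<close>
  are off \<open>z\<close>, so the switch from \<open>y\<close> to \<open>w\<close> sends the first
  agent of \<open>y\<close> from \<open>x\<close> to \<open>z\<close>; it neither leaves
  \<open>y\<close> nor joins \<open>w\<close>.\<close>

lemma pair_straight:
  assumes T: "x \<in> T - {z}" "y \<in> T - {z}" "w \<in> T - {z}" and n: "2 \<le> card N"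
    and xyw: "x \<noteq> y" "x \<noteq> w" "y \<noteq> w"
    and inj: "first z x \<noteq> first z y" "first z x \<noteq> first z w" "first z y \<noteq> first z w"
  shows "pos z {#x, y#} (first z x) = x"
proof (rule ccontr)
  let ?a = "first z x" and ?b = "first z y" and ?c = "first z w"
  assume "pos z {#x, y#} ?a \<noteq> x"
  then have a: "pos z {#x, y#} ?a = y" using first_pos_pair[OF T(1,2) n] by auto
  have N: "?a \<in> N" "?b \<in> N" "?c \<in> N" using first_pos T n by auto
  have "pos z {#x, y#} ?b \<noteq> y"
    using pos_unique[of "{#x, y#}" y ?a ?b] a N T n inj xyw by auto
  then have b: "pos z {#x, y#} ?b = x"
    using first_pos_pair[OF T(2,1) n] by (auto simp: add_mset_commute)
  have ac: "{?a, ?c} \<subseteq> off z {#x, w#}"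
    using first_in_off_pair[OF T(1,3) n] first_in_off_pair[OF T(3,1) n]
    by (auto simp: add_mset_commute)
  moreover have "card (off z {#x, w#}) = 2" using card_off[of "{#x, w#}"] T n by simp
  ultimately have "off z {#x, w#} = {?a, ?c}"
    using inj finite_off by (metis card_2_iff card_subset_eq)
  then have "?b \<notin> off z {#x, w#}" using inj by simp
  then have "pos z {#x, w#} ?b = z" using N by (simp add: off_def)
  then show False
    using swap_pos[of "{#x#}" y w ?b] b T n N xyw by (auto simp: add_mset_commute)
qed

text \<open>By induction, removing any unit other than one \<open>x\<close> puts the agent back on
  \<open>x\<close>, so a stray agent sits on every such unit. Pairs of distinct tasks are settled by
  \<open>pair_straight\<close>; larger demands reduce to one \<open>x\<close> with copies of a
  single \<open>y\<close>, which two further tasks exclude.\<close>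

lemma first_fixed:
  assumes inj: "inj_on (first z) (T - {z})" and "4 \<le> card (T - {z})"
    and "set_mset M \<subseteq> T - {z}" "size M \<le> card N" "x \<in># M"
  shows "pos z M (first z x) = x"
  using assms(3-)
proof (induction "size M" arbitrary: M x rule: less_induct)
  case less
  have pos_size: "0 < size M" using less.prems(3) by (auto simp flip: nonempty_has_size)
  then have n1: "1 \<le> card N" using less.prems(2) by simp
  \<comment> \<open>Without one unit of \<open>y\<close> the agent is on \<open>v\<close> by
    induction; restoring the unit can only draw it to \<open>y\<close>.\<close>
  have two_places: "pos z M' (first z v) = v \<or> pos z M' (first z v) = y"
    if M': "set_mset M' \<subseteq> T - {z}" "size M' = size M" "y \<in># M'" "v \<in># M' - {#y#}" for M' v y
  proof -
    have v: "v \<in> T - {z}" "first z v \<in> N"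
      using M' less.prems n1 first_pos(1)[of v] by (auto dest: in_diffD)
    have sz: "size (M' - {#y#}) < size M" using M' pos_size by (simp add: size_Diff_singleton)
    have "pos z (M' - {#y#}) (first z v) = v"
      by (rule less.hyps[OF sz]) (use M' less.prems sz in \<open>auto dest: in_diffD\<close>)
    then show ?thesis
      using up_pos[of "M' - {#y#}" y "first z v"] v M' less.prems sz
      by (auto dest: in_diffD)
  qed
  have x: "x \<in> T - {z}" using less.prems by auto
  obtain R0 where R0: "M = add_mset x R0" using less.prems(3) by (metis insert_DiffM)
  consider "R0 = {#}" | y where "R0 = {#y#}" | "2 \<le> size R0"
    by (metis One_nat_def Suc_1 Suc_leI leI less_one nat_neq_iff size_1_singleton_mset size_eq_0_iff_empty)
  then show ?case
  proof cases
    case 1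
    then show ?thesis using first_pos(2)[of x] x less.prems R0 by auto
  next
    case 2
    show ?thesis
    proof (cases "y = x")
      case True
      then show ?thesis using first_pos_pair[of x x] 2 x less.prems R0 by auto
    next
      case False
      have y: "y \<in> T - {z}" using less.prems 2 R0 by auto
      have "\<not> T - {z} \<subseteq> {x, y}"
      proof
        assume "T - {z} \<subseteq> {x, y}"
        then have "card (T - {z}) \<le> card {x, y}" by (intro card_mono) auto
        also have "\<dots> \<le> 2" by (simp add: card_insert_if)
        finally show False using assms(2) by simp
      qed
      then obtain w where "w \<in> T - {z}" "w \<noteq> x" "w \<noteq> y" by blast
      then show ?thesis
        using pair_straight[of x y w] False x y 2 R0 less.prems inj
        by (auto simp: inj_on_eq_iff)
    qed
  next
    case 3
    show ?thesis
    proof (rule ccontr)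
      assume nx: "pos z M (first z x) \<noteq> x"
      define y where "y = pos z M (first z x)"
      have all_y: "v = y" if "v \<in># R0" for v
        using two_places[of M v x] that nx less.prems R0 by (auto simp: y_def)
      have "y \<noteq> x" using nx by (simp add: y_def)
      obtain r where r: "size R0 = Suc (Suc r)" using 3 by (metis Suc_le_D numeral_2_eq_2 Suc_le_mono)
      have "R0 = replicate_mset (size R0) y"
        using all_y by (metis set_mset_subset_singletonD singletonI subsetI)
      then have "R0 = replicate_mset (Suc (Suc r)) y" using r by simp
      then have R0': "R0 = add_mset y (add_mset y (replicate_mset r y))" by simp
      define R where "R = add_mset x (add_mset y (replicate_mset r y))"
      have M_eq: "M = add_mset y R" by (simp add: R_def R0 R0' add_mset_commute)
      have T: "y \<in> T - {z}" "set_mset R \<subseteq> T - {z}" "size R < card N" "y \<in># R" "x \<in># R"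
        using less.prems M_eq by (auto simp: R_def)
      have a: "first z x \<in> N" using first_pos(1)[of x] x less.prems R0 by auto
      \<comment> \<open>Since first z x moves from x to y, the switch from w to y is a relay through x, so
        first z w lands on x. This would hold for two different w, but x has demand 1.\<close>
      have key: "pos z M (first z w) = x" if w: "w \<in> T - {z}" "w \<noteq> x" "w \<noteq> y" for w
      proof -
        let ?M' = "add_mset w R"
        have M': "set_mset ?M' \<subseteq> T - {z}" "size ?M' = size M" using T w M_eq by auto
        \<comment> \<open>Two different units, \<open>w\<close> and \<open>y\<close>, can be removed
          here, and the resulting pairs of possible places share only \<open>x\<close>. For
          \<open>first z w\<close> the removable units are \<open>x\<close> and
          \<open>y\<close>.\<close>
        have "pos z ?M' (first z x) = x"
          using two_places[OF M', of w x] two_places[OF M', of y x] T w \<open>y \<noteq> x\<close>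
          by (auto simp: R_def)
        moreover have fw: "pos z ?M' (first z w) = w"
          using two_places[OF M', of x w] two_places[OF M', of y w] T w \<open>y \<noteq> x\<close>
          by auto
        ultimately obtain p where p: "p \<in> N" "pos z ?M' p = w" "pos z M p = x"
          using swap_relay[OF T(2,3) w(1) T(1) w(3) a] w \<open>y \<noteq> x\<close>
          unfolding M_eq[symmetric] by (metis y_def)
        have "count ?M' w = 1" using w by (simp add: R_def)
        then have "p = first z w"
          using pos_unique[of ?M' w p "first z w"] p fw M' less.prems first_pos(1)[of w] w R0
          by auto
        then show ?thesis using p by simp
      qed
      have "\<exists>w w'. w \<in> T - {z} - {x, y} \<and> w' \<in> T - {z} - {x, y} \<and> w \<noteq> w'"
      proof -
        have "2 \<le> card (T - {z} - {x, y})"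
        proof -
          have "card (T - {z}) - card {x, y} \<le> card (T - {z} - {x, y})"
            by (rule diff_card_le_card_Diff) simp
          then show ?thesis using assms(2) \<open>y \<noteq> x\<close> by simp
        qed
        then obtain P where "P \<subseteq> T - {z} - {x, y}" "card P = 2"
          by (metis obtain_subset_with_card_n)
        then show ?thesis by (auto simp: card_2_iff)
      qed
      then obtain w w' where w: "w \<in> T - {z} - {x, y}" "w' \<in> T - {z} - {x, y}" "w \<noteq> w'"
        by blast
      have "count M x = 1" using \<open>y \<noteq> x\<close> by (simp add: M_eq R_def)
      then have "first z w = first z w'"
        using pos_unique[of M x "first z w" "first z w'"] key[of w] key[of w'] w
          less.prems first_pos(1)[of w] first_pos(1)[of w'] R0 by auto
      then show False using inj w by (auto simp: inj_on_eq_iff)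
    qed
  qed
qed

text \<open>By \<open>first_fixed\<close> the removed agent absorbs the added unit of
  \<open>x\<close> in every demand, so the others meet the rest exactly and switch no more often
  than before.\<close>

lemma drop_first:
  assumes inj: "inj_on (first z) (T - {z})" and "4 \<le> card (T - {z})"
    and x: "x \<in> T - {z}" and n: "1 \<le> card N"
  shows "low_cost_assignment (N - {first z x}) T (\<lambda>M. g (add_mset x M))"
proof
  let ?a = "first z x"
  have a: "?a \<in> N" using first_pos x n by blast
  have card_N: "Suc (card (N - {?a})) = card N"
    using a finite_agents n by simp
  show "finite (N - {?a})" using finite_agents by simp
  show "image_mset (g (add_mset x M)) (mset_set (N - {?a})) = M"
    if M: "set_mset M \<subseteq> T" "size M = card (N - {?a})" for M
  proof -
    \<comment> \<open>\<open>M\<close> may contain \<open>z\<close>. Stripping every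
      \<open>z\<close> gives a demand whose padding is \<open>add_mset x M\<close> again and to
      which \<open>first_fixed\<close> applies.\<close>
    define M0 where "M0 = filter_mset (\<lambda>t. t \<noteq> z) (add_mset x M)"
    have split: "add_mset x M = M0 + replicate_mset (count (add_mset x M) z) z"
      unfolding M0_def by (rule multiset_eqI) simp
    have sz: "size M0 + count (add_mset x M) z = card N"
      using arg_cong[OF split, of size] M(2) card_N by simp
    have "pos z M0 ?a = x"
      using M x sz by (intro first_fixed[OF assms(1,2)]) (auto simp: M0_def)
    moreover have "pos z M0 = g (add_mset x M)"
      unfolding pos_def using sz split by (metis add_diff_cancel_left')
    ultimately have "g (add_mset x M) ?a = x" by simp
    moreover have "image_mset (g (add_mset x M)) (mset_set N) = add_mset x M"
      using M x card_N by (intro demand_met) auto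
    moreover have "mset_set N = add_mset ?a (mset_set (N - {?a}))"
      using a finite_agents by (rule mset_set.remove[rotated])
    ultimately show ?thesis by simp
  qed
  show "card {c \<in> N - {?a}. g (add_mset x (add_mset i R)) c \<noteq> g (add_mset x (add_mset j R)) c} \<le> 2"
    if "i \<in> T" "j \<in> T" "set_mset R \<subseteq> T" "Suc (size R) = card (N - {?a})" for i j R
  proof -
    have "card {c \<in> N - {?a}. g (add_mset x (add_mset i R)) c \<noteq> g (add_mset x (add_mset j R)) c}
      \<le> card {c \<in> N. g (add_mset i (add_mset x R)) c \<noteq> g (add_mset j (add_mset x R)) c}"
      using finite_agents by (intro card_mono) (auto simp: add_mset_commute)
    also have "\<dots> \<le> 2" using that x card_N by (intro cost_le_2) auto
    finally show ?thesis .
  qed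
qed

section \<open>Distinct tasks have distinct first agents\<close>

text \<open>An agent \<open>p\<close> off \<open>z\<close> only on the first pair does not join
  \<open>w\<close>, so it leaves \<open>y\<close>, where it is alone. As \<open>e\<close> moves
  without leaving \<open>y\<close>, the switch is a relay in which \<open>p\<close> takes over the
  task of \<open>e\<close>; but that task is not \<open>z\<close>.\<close>

lemma off_pair_eq_if_moved:
  assumes T: "x \<in> T - {z}" "y \<in> T - {z}" "w \<in> T - {z}" and n: "2 \<le> card N"
    and xyw: "x \<noteq> y" "x \<noteq> w" "y \<noteq> w"
    and e: "e \<in> off z {#x, y#}" "e \<in> off z {#x, w#}"
    and moved: "pos z {#x, y#} e \<noteq> pos z {#x, w#} e"
  shows "off z {#x, y#} = off z {#x, w#}"
proof (rule card_subset_eq[OF finite_off])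
  show "card (off z {#x, y#}) = card (off z {#x, w#})"
    using card_off[of "{#x, y#}"] card_off[of "{#x, w#}"] T n by simp
  show "off z {#x, y#} \<subseteq> off z {#x, w#}"
  proof
    fix p assume p: "p \<in> off z {#x, y#}"
    show "p \<in> off z {#x, w#}"
    proof (rule ccontr)
      assume "p \<notin> off z {#x, w#}"
      then have pz: "pos z {#x, w#} p = z" "p \<in> N" "p \<noteq> e" "e \<in> N"
        using p e by (auto simp: off_def)
      then have py: "pos z {#x, y#} p = y"
        using swap_pos[of "{#x#}" y w p] p T n xyw by (auto simp: add_mset_commute off_def)
      have uniq: "c = p" if "c \<in> N" "pos z {#x, y#} c = y" for c
        using pos_unique[of "{#x, y#}" y c p] that py pz T n xyw by auto
      have "pos z {#x, y#} e \<noteq> y" using uniq[of e] pz by auto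
      then obtain c where "c \<in> N" "pos z {#x, y#} c = y" "pos z {#x, w#} c = pos z {#x, y#} e"
        using swap_relay[of "{#x#}" y w e] T n xyw moved pz by (auto simp: add_mset_commute)
      then show False using uniq[of c] pz e by (auto simp: off_def)
    qed
  qed
qed

text \<open>If \<open>e\<close> has the same task on \<open>{#x, y#}\<close> and
  \<open>{#x, w#}\<close>, this is \<open>x\<close>. On \<open>{#y, w#}\<close> it is elsewhere, so
  it moves between that pair and each of the other two, which links them.\<close>

lemma off_pair_eq_if_common:
  assumes T: "x \<in> T - {z}" "y \<in> T - {z}" "w \<in> T - {z}" and n: "2 \<le> card N"
    and xyw: "x \<noteq> y" "x \<noteq> w" "y \<noteq> w"
    and e: "e \<in> off z {#x, y#}" "e \<in> off z {#x, w#}" "e \<in> off z {#y, w#}"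
  shows "off z {#x, y#} = off z {#x, w#}"
proof (cases "pos z {#x, y#} e = pos z {#x, w#} e")
  case False
  then show ?thesis by (intro off_pair_eq_if_moved) (use assms in auto)
next
  case True
  have mem: "pos z {#u, v#} e \<in> {u, v}" if "e \<in> off z {#u, v#}" "u \<in> T - {z}" "v \<in> T - {z}" for u v
    using pos_mem[of "{#u, v#}" e] that n by (auto simp: off_def)
  have perm: "{#y, x#} = {#x, y#}" "{#w, x#} = {#x, w#}" "{#w, y#} = {#y, w#}"
    by (simp_all add: add_mset_commute)
  have "pos z {#x, y#} e = x" "pos z {#x, w#} e = x"
    using True mem[OF e(1)] mem[OF e(2)] T xyw by auto
  moreover have "pos z {#y, w#} e \<noteq> x" using mem[OF e(3)] T xyw by auto
  ultimately have "off z {#y, x#} = off z {#y, w#}" "off z {#w, x#} = off z {#w, y#}"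
    using off_pair_eq_if_moved[of y x w e] off_pair_eq_if_moved[of w x y e] T n xyw e
    unfolding perm by auto
  then show ?thesis by (simp add: add_mset_commute)
qed

text \<open>The position of \<open>e\<close> makes \<open>R\<close> a tournament on
  \<open>U\<close>. Every tournament on four vertices has a Hamiltonian path, and
  \<open>no_chain\<close> forbids one.\<close>

lemma no_two_agents_on_all_pairs:
  assumes U: "U \<subseteq> T - {z}" "x1 \<in> U" "x2 \<in> U" "x3 \<in> U" "x4 \<in> U"
    and dist: "distinct [x1, x2, x3, x4]" and n: "3 \<le> card N" and eq: "e \<noteq> q"
    and pairs: "\<And>x y. x \<in> U \<Longrightarrow> y \<in> U \<Longrightarrow> x \<noteq> y \<Longrightarrow> off z {#x, y#} = {e, q}"
  shows False
proof -
  define R where "R x y \<longleftrightarrow> pos z {#x, y#} e = x" for x y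
  have N: "e \<in> N" "q \<in> N" using pairs[of x1 x2] U dist by (auto simp: off_def)
  have at: "pos z {#x, y#} e = x \<and> pos z {#x, y#} q = y \<or> pos z {#x, y#} e = y \<and> pos z {#x, y#} q = x"
    if "x \<in> U" "y \<in> U" "x \<noteq> y" for x y
  proof -
    have s: "set_mset {#x, y#} \<subseteq> T - {z}" "size {#x, y#} \<le> card N" using that U n by auto
    have "pos z {#x, y#} e \<noteq> z" "pos z {#x, y#} q \<noteq> z"
      using pairs[OF that] by (auto simp: off_def)
    then have "pos z {#x, y#} e \<in> {x, y}" "pos z {#x, y#} q \<in> {x, y}"
      using pos_mem[OF s N(1)] pos_mem[OF s N(2)] by auto
    moreover have "pos z {#x, y#} e \<noteq> pos z {#x, y#} q"
      using pos_unique[OF s, of x e q] pos_unique[OF s, of y e q] eq N that calculation by auto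
    ultimately show ?thesis by auto
  qed
  have R_pos: "pos z {#x, y#} e = x" "pos z {#x, y#} q = y" if "R x y" "x \<in> U" "y \<in> U" "x \<noteq> y" for x y
    using at[of x y] that by (auto simp: R_def)
  have total: "R x y \<or> R y x" if "x \<in> U" "y \<in> U" "x \<noteq> y" for x y
    using at[of x y] that by (auto simp: R_def add_mset_commute)
  have up: "pos z {#x, y, w#} c = pos z {#x, y#} c \<or> pos z {#x, y, w#} c = w"
    if "x \<in> U" "y \<in> U" "w \<in> U" "x \<noteq> y" "c \<in> {e, q}" for x y w c
  proof -
    have "pos z (add_mset w {#x, y#}) c = pos z {#x, y#} c \<or> pos z (add_mset w {#x, y#}) c = w"
      by (rule up_pos) (use that U n N pairs[of x y] in \<open>auto simp: off_def\<close>)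
    moreover have "add_mset w {#x, y#} = {#x, y, w#}" by (simp add: add_mset_commute)
    ultimately show ?thesis by simp
  qed
  have trans: "R x w" "pos z {#x, y, w#} e = x" "pos z {#x, y, w#} q = w"
    if R: "R x y" "R y w" and xyw: "x \<in> U" "y \<in> U" "w \<in> U" "x \<noteq> y" "x \<noteq> w" "y \<noteq> w" for x y w
  proof -
    have perm: "{#x, w, y#} = {#x, y, w#}" "{#y, w, x#} = {#x, y, w#}" "{#w, x, y#} = {#x, y, w#}"
      by (simp_all add: add_mset_commute)
    show xw: "R x w"
    proof (rule ccontr)
      assume "\<not> R x w"
      then have "R w x" using total xyw by blast
      \<comment> \<open>In a cycle the three pairs restrict \<open>e\<close> on the triple to
        \<open>x\<close> or \<open>w\<close>, to \<open>y\<close> or \<open>x\<close>, and to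
        \<open>w\<close> or \<open>y\<close>; no task is in all three.\<close>
      then show False
        using up[of x y w e] up[of y w x e] up[of w x y e] R R_pos xyw unfolding perm by auto
    qed
    show "pos z {#x, y, w#} e = x" "pos z {#x, y, w#} q = w"
      \<comment> \<open>The same intersection for a chain leaves only its top for \<open>e\<close>
        and its bottom for \<open>q\<close>.\<close>
      using up[of x y w e] up[of y w x e] up[of x w y e] up[of x y w q] up[of y w x q] up[of x w y q]
        R_pos[OF R(1)] R_pos[OF R(2)] R_pos[OF xw] xyw
      unfolding perm by auto
  qed
  have no_chain: False
    if R: "R t x" "R x y" "R y w"
      and U': "t \<in> U" "x \<in> U" "y \<in> U" "w \<in> U"
      and ne: "t \<noteq> x" "t \<noteq> y" "t \<noteq> w" "x \<noteq> y" "x \<noteq> w" "y \<noteq> w" for t x y w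
  proof -
    have s: "set_mset {#x, y#} \<subseteq> T - {z}" "size {#x, y#} < card N" "t \<in> T - {z}" "w \<in> T - {z}"
      using U U' n by auto
    have 1: "pos z {#t, x, y#} e = t" "pos z {#t, x, y#} q = y" using trans[of t x y] that by auto
    have 2: "pos z {#w, x, y#} e = x" "pos z {#w, x, y#} q = w"
      using trans[of x y w] that by (auto simp: add_mset_commute)
    \<comment> \<open>\<open>q\<close> goes from \<open>y\<close> to \<open>w\<close> without
      leaving \<open>t\<close>, so whoever leaves \<open>t\<close> must land on \<open>y\<close>.
      The only agent on \<open>t\<close> is \<open>e\<close>, and it lands on
      \<open>x\<close>.\<close>
    obtain c where "c \<in> N" "pos z {#t, x, y#} c = t" "pos z {#w, x, y#} c = y"
      using swap_relay[OF s ne(3) N(2)] 1 2 ne by metis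
    moreover have "c = e"
      using pos_unique[of "{#t, x, y#}" t c e] calculation 1 N s ne n by auto
    ultimately show False using 2 ne by auto
  qed
  have path3: "\<exists>a b c. {a, b, c} = {x, y, w} \<and> R a b \<and> R b c"
    if "R x y" "x \<in> U" "y \<in> U" "w \<in> U" "x \<noteq> w" "y \<noteq> w" for x y w
  proof -
    have "R y w \<or> R x w \<and> R w y \<or> R w x" using total that by blast
    moreover have "{x, w, y} = {x, y, w}" "{w, x, y} = {x, y, w}" by auto
    ultimately show ?thesis using that(1) by blast
  qed
  have "R x1 x2 \<or> R x2 x1" using total U dist by simp
  then have "\<exists>a b c. {a, b, c} = {x1, x2, x3} \<and> R a b \<and> R b c"
  proof
    assume "R x1 x2"
    then show ?thesis using U dist by (intro path3) auto
  next
    assume "R x2 x1"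
    then have "\<exists>a b c. {a, b, c} = {x2, x1, x3} \<and> R a b \<and> R b c"
      using U dist by (intro path3) auto
    then show ?thesis by (simp only: insert_commute)
  qed
  then obtain a b c where abc: "{a, b, c} = {x1, x2, x3}" "R a b" "R b c" by blast
  have "card {a, b, c} = 3" unfolding abc(1) using dist by simp
  then have ne: "a \<noteq> b" "a \<noteq> c" "b \<noteq> c" by (auto simp: card_insert_if split: if_splits)
  have in_abc: "t \<in> U \<and> t \<noteq> x4" if "t \<in> {a, b, c}" for t
    using that dist U unfolding abc(1) by auto
  have in_U: "a \<in> U" "b \<in> U" "c \<in> U" "a \<noteq> x4" "b \<noteq> x4" "c \<noteq> x4"
    using in_abc by simp_all
  \<comment> \<open>\<open>x4\<close> fits at the front, in one of the two gaps or at the end of the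
    path \<open>a\<close>, \<open>b\<close>, \<open>c\<close>.\<close>
  have "R x4 a \<or> R a x4 \<and> R x4 b \<or> R b x4 \<and> R x4 c \<or> R c x4"
    using total U(5) in_U by blast
  then show False
    using no_chain[of x4 a b c] no_chain[of a x4 b c] no_chain[of a b x4 c] no_chain[of a b c x4]
      abc(2,3) ne in_U U(5) by auto
qed

text \<open>A first agent shared by \<open>x\<close> and \<open>y\<close> is off \<open>z\<close> on
  all pairs of every triple containing both. This spreads a single off-set over all pairs from four
  tasks.\<close>

lemma inj_first:
  assumes T: "4 \<le> card (T - {z})" and n: "3 \<le> card N"
  shows "inj_on (first z) (T - {z})"
proof (rule inj_onI, rule ccontr)
  fix x y assume xy: "x \<in> T - {z}" "y \<in> T - {z}" "first z x = first z y" "x \<noteq> y"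
  have "2 \<le> card (T - {z} - {x, y})"
  proof -
    have "card (T - {z}) - card {x, y} \<le> card (T - {z} - {x, y})"
      by (rule diff_card_le_card_Diff) simp
    then show ?thesis using T xy by simp
  qed
  then obtain P where "P \<subseteq> T - {z} - {x, y}" "card P = 2"
    by (metis obtain_subset_with_card_n)
  then obtain u v where uv: "u \<in> T - {z} - {x, y}" "v \<in> T - {z} - {x, y}" "u \<noteq> v"
    by (auto simp: card_2_iff)
  have n2: "2 \<le> card N" using n by simp
  have off1: "first z s \<in> off z {#s, t#}" "first z s \<in> off z {#t, s#}"
    if "s \<in> T - {z}" "t \<in> T - {z}" for s t
    using first_in_off_pair[OF that n2] by (simp_all add: add_mset_commute)
  have tri: "off z {#x, y#} = off z {#x, w#}" "off z {#x, y#} = off z {#y, w#}"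
    if w: "w \<in> T - {z}" "w \<noteq> x" "w \<noteq> y" for w
    using off_pair_eq_if_common[of x y w "first z x"] off_pair_eq_if_common[of y x w "first z x"]
      off1[of x y] off1[of x w] off1[of y w] xy w n2
    by (auto simp: add_mset_commute)
  \<comment> \<open>\<open>first z v\<close> is off \<open>z\<close> on \<open>{#x, v#}\<close>,
    hence by \<open>tri\<close> also on \<open>{#x, u#}\<close>; so it is common to all pairs of the
    triple \<open>u\<close>, \<open>x\<close>, \<open>v\<close>.\<close>
  have "off z {#x, u#} = off z {#u, v#}"
    using off_pair_eq_if_common[of u x v "first z v"] tri[of u] tri[of v]
      off1[of v x] off1[of v u] xy uv n2 by (auto simp: add_mset_commute)
  then have uv_eq: "off z {#u, v#} = off z {#x, y#}" using tri[of u] uv by simp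
  have "card (off z {#x, y#}) = 2" using card_off[of "{#x, y#}"] xy n2 by simp
  then obtain e q where eq: "off z {#x, y#} = {e, q}" "e \<noteq> q" by (auto simp: card_2_iff)
  have pairs: "off z {#x, y#} = {e, q}" "off z {#x, u#} = {e, q}" "off z {#x, v#} = {e, q}"
    "off z {#y, u#} = {e, q}" "off z {#y, v#} = {e, q}" "off z {#u, v#} = {e, q}"
    using tri[of u] tri[of v] uv uv_eq unfolding eq(1)[symmetric] by simp_all
  have flip: "off z {#t, s#} = off z {#s, t#}" for s t by (simp add: add_mset_commute)
  note flipped = pairs[THEN trans[OF flip]]
  show False
  proof (rule no_two_agents_on_all_pairs[of "{x, y, u, v}" x y u v e q])
    show "off z {#s, t#} = {e, q}" if "s \<in> {x, y, u, v}" "t \<in> {x, y, u, v}" "s \<noteq> t" for s t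
      using that by (elim insertE emptyE) (simp_all only: pairs flipped simp_thms)
  qed (use xy uv n eq in auto)
qed

end

section \<open>Descent on the number of agents\<close>

lemma no_low_cost_assignment:
  assumes "low_cost_assignment N T g" "3 \<le> card N" "5 \<le> card T"
  shows False
  using assms
proof (induction "card N" arbitrary: N g rule: less_induct)
  case less
  have "T \<noteq> {}" "finite T" using less.prems by (auto intro: card_ge_0_finite)
  then obtain z where z: "z \<in> T" by blast
  interpret low_cost_assignment N T g by fact
  interpret based_assignment N T g z by standard (fact z)
  have T: "4 \<le> card (T - {z})" using z \<open>finite T\<close> less.prems by simp
  have inj: "inj_on (first z) (T - {z})" using inj_first T less.prems by blast
  have into: "first z ` (T - {z}) \<subseteq> N" using first_pos(1) less.prems by auto
  have "card (T - {z}) \<le> card N" by (rule card_inj_on_le[OF inj into finite_agents])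
  \<comment> \<open>With four agents, at least three remain after the removal, so the induction
    needs no separate base case.\<close>
  then have n: "4 \<le> card N" using T by simp
  obtain x where x: "x \<in> T - {z}" using T by (metis all_not_in_conv card.empty not_numeral_le_zero)
  have "first z x \<in> N" using into x by blast
  then have c: "card (N - {first z x}) = card N - 1" by simp
  show False
    by (rule less.hyps[OF _ drop_first[OF inj T x]]) (use n c less.prems in auto)
qed

section \<open>Translation to demand vectors\<close>

text \<open>\<open>Max\<close> bounds its elements only on a finite set; here every cost is at most
  \<open>n\<close>.\<close>

lemma max_switching_cost_ge:
  assumes "v \<in> demand_vectors n k" "v' \<in> demand_vectors n k" "adjacent k v v'"
  shows "switching_cost n f v v' \<le> max_switching_cost n k f"
  unfolding max_switching_cost_def
proof (rule Max_ge)
  let ?S = "{switching_cost n f v v' |v v'.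
    v \<in> demand_vectors n k \<and> v' \<in> demand_vectors n k \<and> adjacent k v v'}"
  have "switching_cost n f v v' \<le> n" for v v'
  proof -
    have "card {a \<in> {1..n}. f a v \<noteq> f a v'} \<le> card {1..n}" by (rule card_mono) auto
    then show ?thesis by (simp add: switching_cost_def)
  qed
  then have "?S \<subseteq> {..n}" by auto
  then show "finite ?S" by (rule finite_subset) simp
  show "switching_cost n f v v' \<in> ?S" using assms by blast
qed

lemma count_in_demand_vectors:
  assumes "set_mset M \<subseteq> {1..k}"
  shows "count M \<in> demand_vectors (size M) k"
proof -
  have "size M = (\<Sum>j\<in>{1..k}. count M j)"
    unfolding size_multiset_overloaded_eq
    by (rule sum.mono_neutral_left) (use assms in \<open>auto simp: count_eq_zero_iff\<close>)
  then show ?thesis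
    using assms by (auto simp: demand_vectors_def count_eq_zero_iff)
qed

lemma adjacent_count:
  assumes "i \<in> {1..k}" "j \<in> {1..k}" "i \<noteq> j"
  shows "adjacent k (count (add_mset i R)) (count (add_mset j R))"
proof -
  have "(\<Sum>t\<in>{1..k}. if count (add_mset i R) t \<le> count (add_mset j R) t
      then count (add_mset j R) t - count (add_mset i R) t
      else count (add_mset i R) t - count (add_mset j R) t) =
    (\<Sum>t\<in>{1..k}. (if t = i then 1 else 0) + (if t = j then 1 else 0))"
    using assms by (intro sum.cong) auto
  also have "\<dots> = 2" using assms by (simp add: sum.distrib)
  finally show ?thesis unfolding adjacent_def .
qed

lemma low_cost_assignment_if_max_switching_cost_le:
  assumes "satisfies_demand n k f" "max_switching_cost n k f \<le> 2"
  shows "low_cost_assignment {1..n} {1..k} (\<lambda>M a. f a (count M))"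
proof
  show "finite {1..n}" by simp
  show "image_mset (\<lambda>a. f a (count M)) (mset_set {1..n}) = M"
    if M: "set_mset M \<subseteq> {1..k}" "size M = card {1..n}" for M
  proof (rule multiset_eqI)
    fix t
    have v: "count M \<in> demand_vectors n k" using count_in_demand_vectors[OF M(1)] M(2) by simp
    have "count (image_mset (\<lambda>a. f a (count M)) (mset_set {1..n})) t
        = card {a \<in> {1..n}. f a (count M) = t}"
      by (simp add: count_image_mset Int_def vimage_def conj_commute)
    also have "\<dots> = count M t"
    proof (cases "t \<in> {1..k}")
      case True
      then show ?thesis using assms(1) v by (auto simp: satisfies_demand_def)
    next
      case False
      \<comment> \<open>Outside \<open>{1..k}\<close> the range condition in
        \<open>satisfies_demand\<close> takes over from the counting condition.\<close>
      then have "{a \<in> {1..n}. f a (count M) = t} = {}" "t \<notin># M"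
        using assms(1) v M by (auto simp: satisfies_demand_def)
      then show ?thesis by (metis card.empty count_eq_zero_iff)
    qed
    finally show "count (image_mset (\<lambda>a. f a (count M)) (mset_set {1..n})) t = count M t" .
  qed
  show "card {a \<in> {1..n}. f a (count (add_mset i R)) \<noteq> f a (count (add_mset j R))} \<le> 2"
    if R: "i \<in> {1..k}" "j \<in> {1..k}" "set_mset R \<subseteq> {1..k}" "Suc (size R) = card {1..n}" for i j R
  \<comment> \<open>For \<open>i = j\<close> the vectors coincide and are not adjacent; the cost is
    then zero.\<close>
  proof (cases "i = j")
    case False
    have "switching_cost n f (count (add_mset i R)) (count (add_mset j R)) \<le> max_switching_cost n k f"
      by (rule max_switching_cost_ge)
        (use R False adjacent_count count_in_demand_vectors[of "add_mset i R" k]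
          count_in_demand_vectors[of "add_mset j R" k] in auto)
    then show ?thesis using assms(2) by (simp add: switching_cost_def)
  qed simp
qed

theorem theorem1:
  fixes n k :: nat and f :: "nat \<Rightarrow> (nat \<Rightarrow> nat) \<Rightarrow> nat"
  assumes "n \<ge> 3" and "k \<ge> 5" and "satisfies_demand n k f"
  shows "max_switching_cost n k f \<ge> 3"
proof (rule ccontr)
  assume "\<not> max_switching_cost n k f \<ge> 3"
  then have "low_cost_assignment {1..n} {1..k} (\<lambda>M a. f a (count M))"
    using assms(3) by (intro low_cost_assignment_if_max_switching_cost_le) auto
  then show False by (rule no_low_cost_assignment) (use assms in auto)
qed

end
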